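(* Let $\mathbf A$ be a balanced residuated poset satisfying $1_x\cdot1_y=1_{xy}$, $1_{x\backslash y}=1_x\cdot1_y$ and $1_{x/y}=1_x\cdot1_y$ for all $x,y\in A$, and let $\mathbf I=\langle\mathrm{Id}^+\mathbf A,\cdot\rangle$ be the join semilattice of its positive idempotents. Then the algebraic reduct $\langle A,\cdot,\backslash,/,1\rangle$ of $\mathbf A$ is the Płonka sum of the semilattice directed system of metamorphisms between its components $\Xi=\{\xi_{pq}\text{ from }\mathbf A_p\text{ to }\mathbf A_q : p\le q\text{ in }\mathbf I\}$ given by $$\xi^1_{pq}=\langle\varphi_{pq}\rangle,\quad \xi^{\cdot}_{pq}=\langle\varphi_{pq},\varphi_{pq},\varphi_{pq}\rangle,\quad \xi^{\backslash}_{pq}=\langle\psi_{pq},\varphi_{pq},\psi_{pq}\rangle,\quad \xi^{/}_{pq}=\langle\psi_{pq},\psi_{pq},\varphi_{pq}\rangle,$$ where $\varphi_{pq},\psi_{pq}\colon A_p\to A_q$ are defined by $\varphi_{pq}(a)=qa$ and $\psi_{pq}(a)=q\backslash a$. Moreover, for all $p,q\in\mathrm{Id}^+\mathbf A$, $a\in A_p$ and $b\in A_q$, $$a\le b\iff\varphi_{ps}(a)\le_s\psi_{qs}(b),\quad\text{where } s=pq.$$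
   Context: A residuated poset is a structure $\mathbf A=\langle A,\le,\cdot,\backslash,/,1\rangle$ such that $\langle A,\le\rangle$ is a poset, $\langle A,\cdot,1\rangle$ is a monoid, and $x\cdot y\le z\iff x\le z/y\iff y\le x\backslash z$ for all $x,y,z\in A$. We write $xy$ for $x\cdot y$. It is balanced if $x\backslash x=x/x$ for all $x\in A$. Notation: $1_x:=x/x$. $\mathrm{Id}^+\mathbf A=\{p\in A: 1\le p,\ pp=p\}$; for $\mathbf A$ balanced, $\langle\mathrm{Id}^+\mathbf A,\cdot\rangle$ is a join semilattice with least element $1$ whose order is the restriction of that of $\mathbf A$. The component $\mathbf A_p$ ($p\in\mathrm{Id}^+\mathbf A$) is $\langle A_p,\le_p,\cdot_p,\backslash_p,/_p,p\rangle$, where $A_p=\{a\in A: a\backslash a=p\}$, the order and the (a priori partial) operations $\cdot_p,\backslash_p,/_p$ are the restrictions of those of $\mathbf A$, and the constant is $p$; under the hypotheses of the claim these sets are closed under $\cdot,\backslash,/$, so that each $\mathbf A_p$ has total operations. A metamorphism $f$ from $\mathbf A$ to $\mathbf B$ (algebras of the same type $\tau$) assigns to each $n$-ary symbol $\sigma$ of $\tau$ (constants included, $n=0$) a tuple $f^\sigma=\langle f^{\sigma0},\dots,f^{\sigma n}\rangle$ of maps $A\to B$ such that $f^{\sigma0}(\sigma^{\mathbf A}(a_1,\dots,a_n))=\sigma^{\mathbf B}(f^{\sigma1}(a_1),\dots,f^{\sigma n}(a_n))$ for all $a_1,\dots,a_n\in A$. Composition and identities are componentwise. A semilattice directed system of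 metamorphisms is a family $\{\xi_{pq}\text{ a metamorphism from }\mathbf A_p\text{ to }\mathbf A_q: p\le q\text{ in }\mathbf I\}$, indexed by a join semilattice $\mathbf I$ (with least element $\bot$ if $\tau$ has constants), with $\xi_{pp}$ the identity metamorphism and $\xi_{qr}\circ\xi_{pq}=\xi_{pr}$ for $p\le q\le r$. Its Płonka sum is the algebra on the disjoint union $\biguplus_pA_p$ with $\sigma(a_1,\dots,a_n)=\sigma^{\mathbf A_q}(\xi^{\sigma1}_{p_1q}(a_1),\dots,\xi^{\sigma n}_{p_nq}(a_n))$ for $a_k\in A_{p_k}$, $q=p_1\vee\dots\vee p_n$, and $\omega=\omega^{\mathbf A_\bot}$ for constant symbols $\omega$. Metamorphisms here are between the algebraic reducts (type $\cdot,\backslash,/,1$). *)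

theory Defs
  imports Main "HOL-Library.FuncSet"
begin

section \<open>Algebras, metamorphisms and Plonka sums\<close>

text \<open>
  An algebra interprets operation symbols of type \<open>'s\<close>; argument tuples are lists.
  A type (similarity type) is an arity function \<open>ar :: 's \<Rightarrow> nat\<close>, and only lists of length
  \<open>ar \<sigma>\<close> with entries in the universe are relevant for \<open>\<sigma>\<close>.
\<close>

record ('s, 'a) alg =
  univ :: "'a set"
  opr :: "'s \<Rightarrow> 'a list \<Rightarrow> 'a"

definition args :: "('s \<Rightarrow> nat) \<Rightarrow> ('s, 'a) alg \<Rightarrow> 's \<Rightarrow> 'a list set" where
  "args ar A \<sigma> = {as. length as = ar \<sigma> \<and> set as \<subseteq> univ A}"

definition is_alg :: "('s \<Rightarrow> nat) \<Rightarrow> ('s, 'a) alg \<Rightarrow> bool" where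
  "is_alg ar A \<longleftrightarrow> (\<forall>\<sigma>. \<forall>as \<in> args ar A \<sigma>. opr A \<sigma> as \<in> univ A)"

definition alg_iso ::
  "('s \<Rightarrow> nat) \<Rightarrow> ('s, 'a) alg \<Rightarrow> ('s, 'b) alg \<Rightarrow> ('a \<Rightarrow> 'b) \<Rightarrow> bool" where
  "alg_iso ar A B h \<longleftrightarrow>
     bij_betw h (univ A) (univ B) \<and>
     (\<forall>\<sigma>. \<forall>as \<in> args ar A \<sigma>. h (opr A \<sigma> as) = opr B \<sigma> (map h as))"

text \<open>
  \<open>f \<sigma> k\<close> is the \<open>k\<close>-th entry of the tuple assigned to \<open>\<sigma>\<close>. It is meaningful only for
  \<open>k \<le> ar \<sigma>\<close> and on the universe of the source algebra, whence the equality \<open>meta_eq\<close>.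
\<close>

type_synonym ('s, 'a, 'b) meta = "'s \<Rightarrow> nat \<Rightarrow> 'a \<Rightarrow> 'b"

definition metamorphism ::
  "('s \<Rightarrow> nat) \<Rightarrow> ('s, 'a) alg \<Rightarrow> ('s, 'b) alg \<Rightarrow> ('s, 'a, 'b) meta \<Rightarrow> bool" where
  "metamorphism ar A B f \<longleftrightarrow>
     (\<forall>\<sigma>. (\<forall>k \<le> ar \<sigma>. f \<sigma> k \<in> univ A \<rightarrow> univ B) \<and>
          (\<forall>as \<in> args ar A \<sigma>.
             f \<sigma> 0 (opr A \<sigma> as) = opr B \<sigma> (map (\<lambda>k. f \<sigma> (Suc k) (as ! k)) [0..<ar \<sigma>])))"

definition meta_eq ::
  "('s \<Rightarrow> nat) \<Rightarrow> ('s, 'a) alg \<Rightarrow> ('s, 'a, 'b) meta \<Rightarrow> ('s, 'a, 'b) meta \<Rightarrow> bool" where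
  "meta_eq ar A f g \<longleftrightarrow> (\<forall>\<sigma>. \<forall>k \<le> ar \<sigma>. \<forall>a \<in> univ A. f \<sigma> k a = g \<sigma> k a)"

definition meta_id :: "('s, 'a, 'a) meta" where
  "meta_id = (\<lambda>\<sigma> k. id)"

definition meta_comp :: "('s, 'b, 'c) meta \<Rightarrow> ('s, 'a, 'b) meta \<Rightarrow> ('s, 'a, 'c) meta" where
  "meta_comp g f = (\<lambda>\<sigma> k. g \<sigma> k \<circ> f \<sigma> k)"

record 'i semilat =
  elems :: "'i set"
  sup_op :: "'i \<Rightarrow> 'i \<Rightarrow> 'i"

definition join_semilattice :: "'i semilat \<Rightarrow> bool" where
  "join_semilattice I \<longleftrightarrow>
     (\<forall>p \<in> elems I. \<forall>q \<in> elems I. sup_op I p q \<in> elems I) \<and>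
     (\<forall>p \<in> elems I. \<forall>q \<in> elems I. \<forall>r \<in> elems I.
        sup_op I (sup_op I p q) r = sup_op I p (sup_op I q r)) \<and>
     (\<forall>p \<in> elems I. \<forall>q \<in> elems I. sup_op I p q = sup_op I q p) \<and>
     (\<forall>p \<in> elems I. sup_op I p p = p)"

definition sl_le :: "'i semilat \<Rightarrow> 'i \<Rightarrow> 'i \<Rightarrow> bool" where
  "sl_le I p q \<longleftrightarrow> p \<in> elems I \<and> q \<in> elems I \<and> sup_op I p q = q"

definition sl_least :: "'i semilat \<Rightarrow> 'i \<Rightarrow> bool" where
  "sl_least I b \<longleftrightarrow> b \<in> elems I \<and> (\<forall>p \<in> elems I. sl_le I b p)"

definition sl_bot :: "'i semilat \<Rightarrow> 'i" where
  "sl_bot I = (THE b. sl_least I b)"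

fun sl_join :: "'i semilat \<Rightarrow> 'i list \<Rightarrow> 'i" where
  "sl_join I [] = sl_bot I"
| "sl_join I [p] = p"
| "sl_join I (p # q # ps) = sup_op I p (sl_join I (q # ps))"

definition semilattice_directed_system ::
  "('s \<Rightarrow> nat) \<Rightarrow> 'i semilat \<Rightarrow> ('i \<Rightarrow> ('s, 'a) alg) \<Rightarrow> ('i \<Rightarrow> 'i \<Rightarrow> ('s, 'a, 'a) meta) \<Rightarrow> bool"
  where
  "semilattice_directed_system ar I A \<xi> \<longleftrightarrow>
     join_semilattice I \<and>
     ((\<exists>\<sigma>. ar \<sigma> = 0) \<longrightarrow> (\<exists>b. sl_least I b)) \<and>
     (\<forall>p \<in> elems I. is_alg ar (A p)) \<and>
     (\<forall>p q. sl_le I p q \<longrightarrow> metamorphism ar (A p) (A q) (\<xi> p q)) \<and>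
     (\<forall>p \<in> elems I. meta_eq ar (A p) (\<xi> p p) meta_id) \<and>
     (\<forall>p q r. sl_le I p q \<and> sl_le I q r \<longrightarrow>
        meta_eq ar (A p) (meta_comp (\<xi> q r) (\<xi> p q)) (\<xi> p r))"

text \<open>
  The disjoint union is the set of pairs \<open>(p, a)\<close> with \<open>a\<close> in the universe of \<open>A p\<close>. For a constant
  symbol the argument list is empty, so its value is the constant of the algebra at the least index.
\<close>

definition plonka_sum ::
  "'i semilat \<Rightarrow> ('i \<Rightarrow> ('s, 'a) alg) \<Rightarrow> ('i \<Rightarrow> 'i \<Rightarrow> ('s, 'a, 'a) meta) \<Rightarrow> ('s, 'i \<times> 'a) alg"
  where
  "plonka_sum I A \<xi> =
     \<lparr> univ = (SIGMA p : elems I. univ (A p)),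
       opr = (\<lambda>\<sigma> xs.
         let q = sl_join I (map fst xs)
         in (q, opr (A q) \<sigma>
                  (map (\<lambda>k. \<xi> (fst (xs ! k)) q \<sigma> (Suc k) (snd (xs ! k))) [0..<length xs]))) \<rparr>"


section \<open>Residuated posets\<close>

text \<open>\<open>x ldiv z\<close> is the left residual (x under z), \<open>z rdiv y\<close> the right residual (z over y).\<close>

class residuated_poset = order + monoid_mult +
  fixes ldiv :: "'a \<Rightarrow> 'a \<Rightarrow> 'a" (infixl "ldiv" 70)
    and rdiv :: "'a \<Rightarrow> 'a \<Rightarrow> 'a" (infixl "rdiv" 70)
  assumes rdiv_residual: "x * y \<le> z \<longleftrightarrow> x \<le> z rdiv y"
    and ldiv_residual: "x * y \<le> z \<longleftrightarrow> y \<le> x ldiv z"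

definition lunit :: "'a::residuated_poset \<Rightarrow> 'a" where
  "lunit x = x rdiv x"

definition pos_idem :: "'a::residuated_poset set" where
  "pos_idem = {p. 1 \<le> p \<and> p * p = p}"

definition pos_idem_semilat :: "'a::residuated_poset semilat" where
  "pos_idem_semilat = \<lparr> elems = pos_idem, sup_op = (*) \<rparr>"

datatype rp_sym = One | Mult | LDiv | RDiv

fun rp_arity :: "rp_sym \<Rightarrow> nat" where
  "rp_arity One = 0"
| "rp_arity Mult = 2"
| "rp_arity LDiv = 2"
| "rp_arity RDiv = 2"

fun rp_opr :: "'a::residuated_poset \<Rightarrow> rp_sym \<Rightarrow> 'a list \<Rightarrow> 'a" where
  "rp_opr e One [] = e"
| "rp_opr e Mult [x, y] = x * y"
| "rp_opr e LDiv [x, y] = x ldiv y"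
| "rp_opr e RDiv [x, y] = x rdiv y"
| "rp_opr e _ _ = undefined"

definition reduct :: "(rp_sym, 'a::residuated_poset) alg" where
  "reduct = \<lparr> univ = UNIV, opr = rp_opr 1 \<rparr>"

definition comp_set :: "'a::residuated_poset \<Rightarrow> 'a set" where
  "comp_set p = {a. a ldiv a = p}"

definition comp_alg :: "'a::residuated_poset \<Rightarrow> (rp_sym, 'a) alg" where
  "comp_alg p = \<lparr> univ = comp_set p, opr = rp_opr p \<rparr>"

definition comp_le :: "'a::residuated_poset \<Rightarrow> 'a \<Rightarrow> 'a \<Rightarrow> bool" where
  "comp_le p a b \<longleftrightarrow> a \<in> comp_set p \<and> b \<in> comp_set p \<and> a \<le> b"

text \<open>The source index \<open>p\<close> only determines the domain \<open>comp_set p\<close> of these maps.\<close>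

definition phi :: "'a::residuated_poset \<Rightarrow> 'a \<Rightarrow> 'a \<Rightarrow> 'a" where
  "phi p q a = q * a"

definition psi :: "'a::residuated_poset \<Rightarrow> 'a \<Rightarrow> 'a \<Rightarrow> 'a" where
  "psi p q a = q ldiv a"

definition xi :: "'a::residuated_poset \<Rightarrow> 'a \<Rightarrow> (rp_sym, 'a, 'a) meta" where
  "xi p q \<sigma> k =
     (case \<sigma> of
        One \<Rightarrow> [phi p q]
      | Mult \<Rightarrow> [phi p q, phi p q, phi p q]
      | LDiv \<Rightarrow> [psi p q, phi p q, psi p q]
      | RDiv \<Rightarrow> [psi p q, psi p q, phi p q]) ! k"

end

(* In a balanced residuated poset every positive idempotent p is central: p (p x) = p x gives
   p \<le> (p x) / (p x) = (p x) \ (p x), hence x p \<le> p x p \<le> p x, and dually p x \<le> x p.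
   Centrality turns the residuation law into q \ (a \ b) = (q a) \ (q \ b) and
   q \ (a / b) = (q \ a) / (q b), which are the metamorphism identities; the equations for the
   local units place all values in the right component. Since 1_x x = x = 1_x \ x, applying
   s = 1_a 1_b to the entries of a basic operation does not change its value. *)

theory Submission
  imports Defs
begin

section \<open>Residuated posets\<close>

lemma mult_ldiv_le: "x * (x ldiv z) \<le> (z::'a::residuated_poset)"
  by (simp add: ldiv_residual)

lemma rdiv_mult_le: "(z rdiv y) * y \<le> (z::'a::residuated_poset)"
  by (simp add: rdiv_residual)

lemma rp_mult_left_mono: "y \<le> z \<Longrightarrow> x * y \<le> x * (z::'a::residuated_poset)"
  by (meson ldiv_residual order_refl order_trans)

lemma rp_mult_right_mono: "y \<le> z \<Longrightarrow> y * x \<le> z * (x::'a::residuated_poset)"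
  by (meson rdiv_residual order_refl order_trans)

lemma le_mult_if_one_le:
  fixes p x :: "'a::residuated_poset"
  assumes "1 \<le> p"
  shows "x \<le> p * x" "x \<le> x * p"
  using rp_mult_right_mono[OF assms, of x] rp_mult_left_mono[OF assms, of x] by simp_all

text \<open>A residual is determined by the elements below it. Residual identities can therefore be
  proved by comparing the inequalities that an arbitrary \<open>u\<close> satisfies.\<close>

lemma ldiv_eqI:
  fixes x y z :: "'a::residuated_poset"
  assumes "\<And>u. x * u \<le> y \<longleftrightarrow> u \<le> z"
  shows "x ldiv y = z"
  by (metis assms ldiv_residual order_antisym order_refl)

lemma rdiv_eqI:
  fixes x y z :: "'a::residuated_poset"
  assumes "\<And>u. u * y \<le> x \<longleftrightarrow> u \<le> z"
  shows "x rdiv y = z"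
  by (metis assms rdiv_residual order_antisym order_refl)

lemma ldiv_ldiv: "x ldiv (y ldiv z) = (y * x) ldiv (z::'a::residuated_poset)"
  by (rule ldiv_eqI) (metis ldiv_residual mult.assoc)

lemma one_le_pos_idem: "p \<in> pos_idem \<Longrightarrow> 1 \<le> p"
  and pos_idem_idem: "p \<in> pos_idem \<Longrightarrow> p * p = p"
  by (simp_all add: pos_idem_def)

lemma one_pos_idem: "1 \<in> pos_idem"
  by (simp add: pos_idem_def)

lemma ldiv_self_mult:
  fixes x :: "'a::residuated_poset"
  shows "x * (x ldiv x) = x"
proof (rule order_antisym[OF mult_ldiv_le])
  have "1 \<le> x ldiv x"
    using ldiv_residual[of x 1 x] by simp
  then show "x \<le> x * (x ldiv x)"
    by (rule le_mult_if_one_le)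
qed

lemma ldiv_self_pos_idem: "x ldiv x \<in> (pos_idem :: 'a::residuated_poset set)"
proof -
  let ?u = "x ldiv x"
  have one: "1 \<le> ?u"
    using ldiv_residual[of x 1 x] by simp
  \<comment> \<open>By residuation the claim is \<open>x * (?u * ?u) \<le> x\<close>, and
    \<open>x\<close> absorbs each factor \<open>?u\<close> in turn.\<close>
  have "?u * ?u \<le> ?u"
    by (simp add: ldiv_residual[symmetric] mult.assoc[symmetric] ldiv_self_mult)
  with one show ?thesis
    by (simp add: pos_idem_def order_antisym le_mult_if_one_le(1))
qed

text \<open>If \<open>p * u \<le> p\<close>, then \<open>u \<le> p * u \<le> p\<close>; conversely
  \<open>u \<le> p\<close> gives \<open>p * u \<le> p * p = p\<close>. Hence \<open>p\<close> lies
  in its own component and can serve as its constant.\<close>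

lemma pos_idem_ldiv_self:
  fixes p :: "'a::residuated_poset"
  assumes "p \<in> pos_idem"
  shows "p ldiv p = p"
proof (rule ldiv_eqI)
  fix u
  show "p * u \<le> p \<longleftrightarrow> u \<le> p"
    using le_mult_if_one_le(1)[OF one_le_pos_idem[OF assms], of u]
      rp_mult_left_mono[of u p p] pos_idem_idem[OF assms]
    by (metis order_trans)
qed

lemma univ_comp_alg: "univ (comp_alg p) = comp_set p"
  by (simp add: comp_alg_def)

lemma args_two_cases:
  assumes "as \<in> args ar A \<sigma>" and "ar \<sigma> = 2"
  obtains x y where "as = [x, y]" "x \<in> univ A" "y \<in> univ A"
  using assms by (auto simp: args_def numeral_2_eq_2 length_Suc_conv)

lemma comp_set_iff: "a \<in> comp_set p \<longleftrightarrow> a ldiv a = p"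
  by (simp add: comp_set_def)

section \<open>Balanced residuated posets\<close>

context
  assumes balanced: "\<forall>x::'a::residuated_poset. x ldiv x = x rdiv x"
begin

lemma lunit_eq_ldiv: "lunit x = x ldiv (x::'a)"
  by (simp add: lunit_def balanced)

lemma comp_set_iff_lunit: "a \<in> comp_set p \<longleftrightarrow> lunit (a::'a) = p"
  by (simp add: comp_set_iff lunit_eq_ldiv)

lemma lunit_pos_idem: "lunit (x::'a) \<in> pos_idem"
  by (simp add: lunit_eq_ldiv ldiv_self_pos_idem)

lemma lunit_of_pos_idem: "p \<in> pos_idem \<Longrightarrow> lunit (p::'a) = p"
  by (simp add: lunit_eq_ldiv pos_idem_ldiv_self)

lemma pos_idem_central:
  fixes x :: "'a"
  assumes p: "p \<in> pos_idem"
  shows "p * x = x * p"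
proof (rule order_antisym)
  note pp = pos_idem_idem[OF p] and one = one_le_pos_idem[OF p]
  have "(x * p) * p \<le> x * p"
    by (simp add: mult.assoc pp)
  then have "p * (x * p) \<le> x * p"
    using balanced by (metis ldiv_residual rdiv_residual)
  then show "p * x \<le> x * p"
    using rp_mult_left_mono[OF le_mult_if_one_le(2)[OF one, of x], of p] by (rule order_trans[rotated])
  have "p * (p * x) \<le> p * x"
    by (simp add: mult.assoc[symmetric] pp)
  then have "(p * x) * p \<le> p * x"
    using balanced by (metis ldiv_residual rdiv_residual)
  then show "x * p \<le> p * x"
    using rp_mult_right_mono[OF le_mult_if_one_le(1)[OF one, of x], of p] by (rule order_trans[rotated])
qed

lemma pos_idem_mult_pos_idem:
  fixes p q :: 'a
  assumes p: "p \<in> pos_idem" and q: "q \<in> pos_idem"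
  shows "p * q \<in> pos_idem"
proof -
  have "p * q * (p * q) = p * (q * p) * q"
    by (simp add: mult.assoc)
  also have "\<dots> = (p * p) * (q * q)"
    by (simp add: pos_idem_central[OF q, of p] mult.assoc)
  finally have "p * q * (p * q) = p * q"
    using p q by (simp add: pos_idem_idem)
  moreover have "1 \<le> p * q"
    using one_le_pos_idem[OF p] le_mult_if_one_le(2)[OF one_le_pos_idem[OF q]]
    by (rule order_trans)
  ultimately show ?thesis
    by (simp add: pos_idem_def)
qed

lemma lunit_mult_self: "lunit x * x = (x::'a)"
  by (metis ldiv_self_mult lunit_eq_ldiv lunit_pos_idem pos_idem_central)

text \<open>Lets \<open>psi\<close> inherit from \<open>phi\<close> every fixed point:
  \<open>p ldiv x \<le> p * (p ldiv x) \<le> x\<close> holds for any \<open>x\<close>, and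
  \<open>p * x = x\<close> supplies the converse.\<close>

lemma ldiv_self_if_mult_self:
  fixes x :: 'a
  assumes p: "p \<in> pos_idem" and "p * x = x"
  shows "p ldiv x = x"
proof (rule order_antisym)
  show "p ldiv x \<le> x"
    using le_mult_if_one_le(1)[OF one_le_pos_idem[OF p]] mult_ldiv_le by (rule order_trans)
  show "x \<le> p ldiv x"
    using assms by (simp add: ldiv_residual[symmetric])
qed

lemma pos_idem_mult_distrib:
  fixes a b :: 'a
  assumes q: "q \<in> pos_idem"
  shows "(q * a) * (q * b) = q * (a * b)"
  by (metis mult.assoc pos_idem_central[OF q] pos_idem_idem[OF q])

text \<open>By \<open>ldiv_ldiv\<close> both sides divide \<open>b\<close> on the left, by
  \<open>q * (q * a)\<close> and by \<open>a * q\<close>. These agree because \<open>q\<close> is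
  central and idempotent.\<close>

lemma pos_idem_ldiv_distrib:
  fixes a b :: 'a
  assumes q: "q \<in> pos_idem"
  shows "(q * a) ldiv (q ldiv b) = q ldiv (a ldiv b)"
  by (metis ldiv_ldiv mult.assoc pos_idem_central[OF q] pos_idem_idem[OF q])

text \<open>An element \<open>u\<close> is below either side exactly when
  \<open>q * u * b \<le> a\<close>.\<close>

lemma pos_idem_rdiv_distrib:
  fixes a b :: 'a
  assumes q: "q \<in> pos_idem"
  shows "(q ldiv a) rdiv (q * b) = q ldiv (a rdiv b)"
proof (rule rdiv_eqI)
  fix u
  have "u * (q * b) \<le> q ldiv a \<longleftrightarrow> q * (u * (q * b)) \<le> a"
    by (simp add: ldiv_residual)
  also have "q * (u * (q * b)) = q * u * b"
    by (metis mult.assoc pos_idem_central[OF q] pos_idem_idem[OF q])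
  also have "q * u * b \<le> a \<longleftrightarrow> u \<le> q ldiv (a rdiv b)"
    by (simp add: ldiv_residual[symmetric] rdiv_residual)
  finally show "u * (q * b) \<le> q ldiv a \<longleftrightarrow> u \<le> q ldiv (a rdiv b)" .
qed

section \<open>The join semilattice of positive idempotents\<close>

lemma elems_pos_idem_semilat: "elems pos_idem_semilat = (pos_idem :: 'a set)"
  by (simp add: pos_idem_semilat_def)

lemma sl_le_pos_idem_semilat:
  "sl_le pos_idem_semilat p q \<longleftrightarrow> p \<in> pos_idem \<and> q \<in> pos_idem \<and> p * q = (q::'a)"
  by (simp add: sl_le_def pos_idem_semilat_def)

lemma join_semilattice_pos_idem: "join_semilattice (pos_idem_semilat :: 'a semilat)"
  by (auto simp: join_semilattice_def pos_idem_semilat_def pos_idem_mult_pos_idem mult.assoc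
      pos_idem_idem intro: pos_idem_central)

lemma sl_least_pos_idem: "sl_least (pos_idem_semilat :: 'a semilat) b \<longleftrightarrow> b = 1"
proof
  assume "sl_least (pos_idem_semilat :: 'a semilat) b"
  then have "sl_le pos_idem_semilat b 1"
    by (simp add: sl_least_def pos_idem_semilat_def one_pos_idem)
  then show "b = 1"
    by (simp add: sl_le_pos_idem_semilat)
next
  assume "b = 1"
  then show "sl_least (pos_idem_semilat :: 'a semilat) b"
    by (simp add: sl_least_def sl_le_pos_idem_semilat elems_pos_idem_semilat one_pos_idem)
qed

lemma sl_bot_pos_idem: "sl_bot (pos_idem_semilat :: 'a semilat) = 1"
  by (simp add: sl_bot_def sl_least_pos_idem)

section \<open>The Plonka sum of the components\<close>

context
  assumes unit_mult: "\<forall>x y::'a. lunit x * lunit y = lunit (x * y)"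
    and unit_ldiv: "\<forall>x y::'a. lunit (x ldiv y) = lunit x * lunit y"
    and unit_rdiv: "\<forall>x y::'a. lunit (x rdiv y) = lunit x * lunit y"
begin

section \<open>Components and the metamorphisms between them\<close>

text \<open>Uses that \<open>q\<close> is its own local unit. When \<open>lunit a = p\<close> and
  \<open>p * q = q\<close>, the new unit is \<open>q\<close>, so \<open>phi\<close> and, by the next
  lemma, \<open>psi\<close> land in the target component.\<close>

lemma lunit_phi: "q \<in> pos_idem \<Longrightarrow> lunit (phi p q a) = q * lunit (a::'a)"
  by (simp add: phi_def unit_mult[rule_format, symmetric] lunit_of_pos_idem)

lemma lunit_psi: "q \<in> pos_idem \<Longrightarrow> lunit (psi p q a) = q * lunit (a::'a)"
  by (simp add: psi_def unit_ldiv lunit_of_pos_idem)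

lemma is_alg_comp_alg:
  assumes p: "(p::'a) \<in> pos_idem"
  shows "is_alg rp_arity (comp_alg p)"
  unfolding is_alg_def
proof (intro allI ballI)
  fix \<sigma> as
  assume as: "as \<in> args rp_arity (comp_alg p) \<sigma>"
  show "opr (comp_alg p) \<sigma> as \<in> univ (comp_alg p)"
  proof (cases "\<sigma> = One")
    case True
    then show ?thesis
      using as p by (simp add: args_def comp_alg_def comp_set_iff_lunit lunit_of_pos_idem)
  next
    case False
    then have "rp_arity \<sigma> = 2"
      by (cases \<sigma>) auto
    with as obtain x y where "as = [x, y]" "x \<in> univ (comp_alg p)" "y \<in> univ (comp_alg p)"
      by (rule args_two_cases)
    then show ?thesis
      using False p
      by (cases \<sigma>) (auto simp: comp_alg_def comp_set_iff_lunit unit_mult[rule_format, symmetric]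
          unit_ldiv unit_rdiv pos_idem_idem)
  qed
qed

lemma xi_comp_set:
  assumes "p * q = (q::'a)" "p \<in> pos_idem" "q \<in> pos_idem" "k \<le> rp_arity \<sigma>"
    and "a \<in> comp_set p"
  shows "xi p q \<sigma> k a \<in> comp_set q"
proof -
  have "phi p q a \<in> comp_set q" "psi p q a \<in> comp_set q"
    using assms pos_idem_central[of p q] by (auto simp: comp_set_iff_lunit lunit_phi lunit_psi)
  moreover have "xi p q \<sigma> k = phi p q \<or> xi p q \<sigma> k = psi p q"
    using assms(4)
    by (cases \<sigma>) (auto simp: xi_def le_Suc_eq numeral_2_eq_2)
  ultimately show ?thesis
    by metis
qed

lemma metamorphism_xi:
  assumes pq: "p * q = (q::'a)" and p: "p \<in> pos_idem" and q: "q \<in> pos_idem"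
  shows "metamorphism rp_arity (comp_alg p) (comp_alg q) (xi p q)"
  unfolding metamorphism_def
proof (intro allI conjI impI ballI)
  fix \<sigma> k
  assume "k \<le> rp_arity \<sigma>"
  then show "xi p q \<sigma> k \<in> univ (comp_alg p) \<rightarrow> univ (comp_alg q)"
    using xi_comp_set[OF pq p q] by (auto simp: comp_alg_def)
next
  fix \<sigma> as
  assume as: "as \<in> args rp_arity (comp_alg p) \<sigma>"
  show "xi p q \<sigma> 0 (opr (comp_alg p) \<sigma> as) =
    opr (comp_alg q) \<sigma> (map (\<lambda>k. xi p q \<sigma> (Suc k) (as ! k)) [0..<rp_arity \<sigma>])"
  proof (cases "\<sigma> = One")
    case True
    then show ?thesis
      \<comment> \<open>The constant \<open>p\<close> is sent to \<open>q * p = p * q = q\<close>,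
        the constant of the target.\<close>
      using as pq pos_idem_central[OF q, of p]
      by (simp add: args_def comp_alg_def xi_def phi_def)
  next
    case False
    then have "rp_arity \<sigma> = 2"
      by (cases \<sigma>) auto
    with as obtain x y where "as = [x, y]"
      by (rule args_two_cases)
    then show ?thesis
      using False q
      \<comment> \<open>Unfolding \<open>[0..<2]\<close> lets the tuples evaluate; what remains are
        the three distribution laws, one for each binary symbol.\<close>
      by (cases \<sigma>) (simp_all add: comp_alg_def xi_def phi_def psi_def upt_rec
          pos_idem_mult_distrib pos_idem_ldiv_distrib pos_idem_rdiv_distrib)
  qed
qed

lemma xi_refl:
  assumes "(p::'a) \<in> pos_idem" "k \<le> rp_arity \<sigma>" "a \<in> comp_set p"
  shows "xi p p \<sigma> k a = a"
proof -
  \<comment> \<open>Here \<open>p\<close> is the local unit of \<open>a\<close>.\<close>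
  have "p * a = a"
    using assms lunit_mult_self[of a] by (simp add: comp_set_iff_lunit)
  then have "phi p p a = a" "psi p p a = a"
    using assms by (simp_all add: phi_def psi_def ldiv_self_if_mult_self)
  then show ?thesis
    using assms(2) by (cases \<sigma>) (auto simp: xi_def le_Suc_eq numeral_2_eq_2)
qed

text \<open>Composing collapses to one step since \<open>r * (q * a) = (r * q) * a\<close>,
  \<open>r ldiv (q ldiv a) = (q * r) ldiv a\<close>, and \<open>r\<close> absorbs
  \<open>q\<close>.\<close>

lemma xi_comp:
  assumes qr: "q * r = (r::'a)" and r: "r \<in> pos_idem" and k: "k \<le> rp_arity \<sigma>"
  shows "xi q r \<sigma> k (xi p q \<sigma> k a) = xi p r \<sigma> k a"
proof -
  have "phi q r (phi p q a) = phi p r a" "psi q r (psi p q a) = psi p r a"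
    using qr pos_idem_central[OF r, of q]
    by (simp_all add: phi_def psi_def ldiv_ldiv mult.assoc[symmetric])
  then show ?thesis
    using k by (cases \<sigma>) (auto simp: xi_def le_Suc_eq numeral_2_eq_2)
qed

lemma directed_system_xi:
  "semilattice_directed_system rp_arity (pos_idem_semilat :: 'a semilat) comp_alg xi"
  unfolding semilattice_directed_system_def sl_le_pos_idem_semilat
  by (auto simp: join_semilattice_pos_idem sl_least_pos_idem is_alg_comp_alg metamorphism_xi
      meta_eq_def meta_id_def meta_comp_def xi_refl xi_comp univ_comp_alg elems_pos_idem_semilat)

section \<open>The Plonka sum and the order of the original algebra\<close>

text \<open>The left sides are the binary operations as computed in the Plonka sum. By the unit
  equations \<open>s\<close> is the local unit of each value on the right, so acting by
  \<open>s\<close> fixes that value, and the distribution laws carry the action to the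
  arguments.\<close>

lemma mult_lunits:
  fixes a b :: 'a
  defines "s \<equiv> lunit a * lunit b"
  shows "(s * a) * (s * b) = a * b"
    and "(s * a) ldiv (s ldiv b) = a ldiv b"
    and "(s ldiv a) rdiv (s * b) = a rdiv b"
proof -
  have s: "s \<in> pos_idem"
    by (simp add: s_def pos_idem_mult_pos_idem lunit_pos_idem)
  have "s = lunit (a * b)" "s = lunit (a ldiv b)" "s = lunit (a rdiv b)"
    by (simp_all add: s_def unit_mult unit_ldiv unit_rdiv)
  then have "s * (a * b) = a * b" "s * (a ldiv b) = a ldiv b" "s * (a rdiv b) = a rdiv b"
    by (metis lunit_mult_self)+
  with s show "(s * a) * (s * b) = a * b" "(s * a) ldiv (s ldiv b) = a ldiv b"
    "(s ldiv a) rdiv (s * b) = a rdiv b"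
    by (simp_all add: pos_idem_mult_distrib pos_idem_ldiv_distrib pos_idem_rdiv_distrib
        ldiv_self_if_mult_self)
qed

lemma alg_iso_plonka_sum:
  "alg_iso rp_arity (plonka_sum (pos_idem_semilat :: 'a semilat) comp_alg xi) reduct snd"
  (is "alg_iso _ ?P _ _")
  unfolding alg_iso_def
proof (intro conjI allI ballI)
  \<comment> \<open>Every \<open>a\<close> lies in exactly one component, the one indexed by its
    local unit, so forgetting the index is a bijection.\<close>
  have univ: "univ ?P = (\<lambda>a. (lunit a, a)) ` UNIV"
    by (auto simp: plonka_sum_def pos_idem_semilat_def comp_alg_def comp_set_iff_lunit
        lunit_pos_idem)
  then show "bij_betw snd (univ ?P) (univ (reduct :: (rp_sym, 'a) alg))"
    by (auto simp: bij_betw_def inj_on_def reduct_def image_image)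
  fix \<sigma> as
  assume as: "as \<in> args rp_arity ?P \<sigma>"
  show "snd (opr ?P \<sigma> as) = opr reduct \<sigma> (map snd as)"
  proof (cases "\<sigma> = One")
    case True
    then show ?thesis
      \<comment> \<open>The empty argument list has join \<open>sl_bot\<close>, which is
        \<open>1\<close>, and the constant of that component is \<open>1\<close>.\<close>
      using as by (simp add: args_def plonka_sum_def comp_alg_def reduct_def sl_bot_pos_idem Let_def)
  next
    case False
    then have "rp_arity \<sigma> = 2"
      by (cases \<sigma>) auto
    with as obtain x y where "as = [x, y]" "x \<in> univ ?P" "y \<in> univ ?P"
      by (rule args_two_cases)
    moreover from this univ obtain a b where "x = (lunit a, a)" "y = (lunit b, b)"
      by auto
    ultimately show ?thesis
      using False
      by (cases \<sigma>) (simp_all add: plonka_sum_def comp_alg_def reduct_def Let_def xi_def phi_def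
          psi_def pos_idem_semilat_def upt_rec mult_lunits)
  qed
qed

text \<open>As \<open>p * a = a\<close> and \<open>?s\<close> is idempotent, residuation reduces the
  right side to \<open>q * a \<le> b\<close>. This is equivalent to \<open>a \<le> b\<close>,
  because \<open>a \<le> q * a\<close> and \<open>q * b = b\<close>.\<close>

lemma le_iff_comp_le:
  fixes a b :: 'a
  assumes p: "p \<in> pos_idem" and q: "q \<in> pos_idem" and a: "a \<in> comp_set p" and b: "b \<in> comp_set q"
  shows "a \<le> b \<longleftrightarrow> comp_le (p * q) (phi p (p * q) a) (psi q (p * q) b)"
proof -
  let ?s = "p * q"
  have s: "?s \<in> pos_idem"
    using p q by (rule pos_idem_mult_pos_idem)
  have "?s * p = ?s" "?s * q = ?s"
    by (metis mult.assoc p q pos_idem_central pos_idem_idem)+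
  then have mem: "phi p ?s a \<in> comp_set ?s" "psi q ?s b \<in> comp_set ?s"
    using a b s by (simp_all add: comp_set_iff_lunit lunit_phi lunit_psi)
  have "p * a = a" "q * b = b"
    using a b lunit_mult_self[of a] lunit_mult_self[of b] by (simp_all add: comp_set_iff_lunit)
  then have "?s * a = q * a" and qb: "q * b = b"
    by (simp_all add: pos_idem_central[OF p, of q] mult.assoc)
  moreover have "?s * a \<le> ?s ldiv b \<longleftrightarrow> ?s * a \<le> b"
    by (metis ldiv_residual mult.assoc pos_idem_idem[OF s])
  moreover have "q * a \<le> b \<longleftrightarrow> a \<le> b"
    using rp_mult_left_mono[of a b q] qb le_mult_if_one_le(1)[OF one_le_pos_idem[OF q], of a]
    by (metis order_trans)
  ultimately show ?thesis
    using mem by (simp add: comp_le_def phi_def psi_def)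
qed

end

end

theorem corollary20:
  assumes balanced: "\<forall>x::'a::residuated_poset. x ldiv x = x rdiv x"
    and unit_mult: "\<forall>x y::'a. lunit x * lunit y = lunit (x * y)"
    and unit_ldiv: "\<forall>x y::'a. lunit (x ldiv y) = lunit x * lunit y"
    and unit_rdiv: "\<forall>x y::'a. lunit (x rdiv y) = lunit x * lunit y"
  shows "semilattice_directed_system rp_arity
           (pos_idem_semilat :: 'a semilat) comp_alg xi
       \<and> alg_iso rp_arity
           (plonka_sum (pos_idem_semilat :: 'a semilat) comp_alg xi) reduct snd
       \<and> (\<forall>p \<in> pos_idem. \<forall>q \<in> pos_idem. \<forall>a \<in> comp_set p. \<forall>b \<in> comp_set q.
            (a::'a) \<le> b \<longleftrightarrow>
            (let s = p * q in comp_le s (phi p s a) (psi q s b)))"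
  using directed_system_xi[OF assms] alg_iso_plonka_sum[OF assms] le_iff_comp_le[OF assms]
  by (simp add: Let_def)

end
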